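(* Let $K$ be a field of characteristic $p>3$ and let $\mathfrak{g}$ be a central simple Lie algebra over $K$. Then every CPA-structure on $\mathfrak{g}$ is trivial, i.e., every CPA-structure $(x,y)\mapsto x\cdot y$ on $\mathfrak{g}$ satisfies $x\cdot y=0$ for all $x,y\in\mathfrak{g}$.
   Context: All Lie algebras are finite-dimensional. A simple Lie algebra is a non-abelian Lie algebra with no nontrivial proper ideals. The centroid $C(\mathfrak{g})$ of a Lie algebra $\mathfrak{g}$ over $K$ is the space of $K$-linear maps $\varphi\colon\mathfrak{g}\to\mathfrak{g}$ with $\varphi([x,y])=[\varphi(x),y]$ for all $x,y\in\mathfrak{g}$. A simple Lie algebra $\mathfrak{g}$ over $K$ is called central simple if $C(\mathfrak{g})=K$ (i.e., consists only of scalar multiples of the identity). A commutative post-Lie algebra structure, or CPA-structure, on a Lie algebra $\mathfrak{g}$ over $K$ is a $K$-bilinear product $x\cdot y$ on $\mathfrak{g}$ satisfying, for all $x,y,z\in\mathfrak{g}$: $x\cdot y=y\cdot x$; $[x,y]\cdot z=x\cdot(y\cdot z)-y\cdot(x\cdot z)$; $x\cdot[y,z]=[x\cdot y,z]+[y,x\cdot z]$. *)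

theory Defs
  imports Complex_Main
begin

text \<open>
  As for \<^locale>\<open>vector_space\<close>, the underlying space of a Lie algebra is a whole type, the field
  of scalars is a type of class \<^class>\<open>field\<close>, and the scalar multiplication is a parameter.
  \<open>Vector_Spaces.linear\<close> is linearity over that field; the unqualified \<open>linear\<close> is the
  real-linear one.
\<close>

definition bilinear_over :: "('k::field \<Rightarrow> 'a::ab_group_add \<Rightarrow> 'a) \<Rightarrow> ('a \<Rightarrow> 'a \<Rightarrow> 'a) \<Rightarrow> bool" where
  "bilinear_over scale f \<longleftrightarrow>
     (\<forall>x. Vector_Spaces.linear scale scale (\<lambda>y. f x y)) \<and>
     (\<forall>y. Vector_Spaces.linear scale scale (\<lambda>x. f x y))"

locale lie_algebra = vector_space scale
  for scale :: "'k::field \<Rightarrow> 'a::ab_group_add \<Rightarrow> 'a" +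
  fixes bracket :: "'a \<Rightarrow> 'a \<Rightarrow> 'a"
  assumes bilinear_bracket: "bilinear_over scale bracket"
    and bracket_self: "bracket x x = 0"
    and jacobi: "bracket x (bracket y z) + bracket y (bracket z x) + bracket z (bracket x y) = 0"
begin

definition abelian :: bool where
  "abelian \<longleftrightarrow> (\<forall>x y. bracket x y = 0)"

definition lie_ideal :: "'a set \<Rightarrow> bool" where
  "lie_ideal I \<longleftrightarrow> subspace I \<and> (\<forall>x. \<forall>y\<in>I. bracket x y \<in> I)"

definition centroid :: "('a \<Rightarrow> 'a) set" where
  "centroid = {\<phi>. Vector_Spaces.linear scale scale \<phi> \<and>
                  (\<forall>x y. \<phi> (bracket x y) = bracket (\<phi> x) y)}"

definition cpa_structure :: "('a \<Rightarrow> 'a \<Rightarrow> 'a) \<Rightarrow> bool" where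
  "cpa_structure m \<longleftrightarrow>
     bilinear_over scale m \<and>
     (\<forall>x y. m x y = m y x) \<and>
     (\<forall>x y z. m (bracket x y) z = m x (m y z) - m y (m x z)) \<and>
     (\<forall>x y z. m x (bracket y z) = bracket (m x y) z + bracket y (m x z))"

end

text \<open>
  \<^locale>\<open>finite_dimensional_vector_space\<close> carries a chosen basis as a parameter; here only
  finite-dimensionality is assumed.
\<close>

locale finite_dimensional_lie_algebra = lie_algebra +
  assumes finite_dimensional: "\<exists>B. finite B \<and> span B = UNIV"

locale simple_lie_algebra = finite_dimensional_lie_algebra +
  assumes not_abelian: "\<not> abelian"
    and ideal_trivial: "lie_ideal I \<Longrightarrow> I = {0} \<or> I = UNIV"

locale central_simple_lie_algebra = simple_lie_algebra +
  assumes centroid_scalars: "centroid = {\<lambda>x. scale c x | c. True}"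

end

theory Submission
  imports Defs
begin

text \<open>
  Write \<open>D\<^sub>x\<close> for multiplication by \<open>x\<close> and \<open>F\<^sub>x = D\<^sub>x + ad x\<close>. The axioms give
  \<open>D\<^sub>y F\<^sub>z = D\<^sub>z F\<^sub>y\<close> and make \<open>F\<close> a representation. By induction on the degree of \<open>A\<close>,
  \<open>D\<^sub>y A F\<^sub>z = D\<^sub>z A F\<^sub>y\<close> for every \<open>A\<close> in the associative algebra generated by the
  maps \<open>ad w\<close>. For central simple algebras this associative algebra acts densely, so
  for linearly independent \<open>y, z\<close> and nonzero \<open>D\<close> the identity forces \<open>F = 0\<close>. Then
  \<open>x \<cdot> y = -[x, y]\<close> is both symmetric and antisymmetric, which is absurd as \<open>2 \<noteq> 0\<close>.
\<close>

lemma scale_linear_simps: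
  assumes "Vector_Spaces.linear scale scale f"
  shows "f (x + y) = f x + f y"
    and "f (x - y) = f x - f y"
    and "f (- x) = - f x"
    and "f 0 = 0"
    and "f (scale c x) = scale c (f x)"
proof -
  interpret module_hom scale scale f
    using assms by (rule Vector_Spaces.linear.axioms(3))
  show "f (x + y) = f x + f y" "f (x - y) = f x - f y" "f (- x) = - f x" "f 0 = 0"
    "f (scale c x) = scale c (f x)"
    by (fact add diff neg zero scale)+
qed

section \<open>The associative algebra generated by the maps \<open>bracket w\<close>, filtered by
  degree\<close>

context lie_algebra
begin

lemma bracket_linear:
  "Vector_Spaces.linear scale scale (bracket x)"
  "Vector_Spaces.linear scale scale (\<lambda>x. bracket x y)"
  using bilinear_bracket by (simp_all add: bilinear_over_def)

lemma bracket_algebra_simps: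
  "bracket x (y + z) = bracket x y + bracket x z"
  "bracket x (y - z) = bracket x y - bracket x z"
  "bracket x (- y) = - bracket x y"
  "bracket x 0 = 0"
  "bracket x (scale c y) = scale c (bracket x y)"
  "bracket (x + y) z = bracket x z + bracket y z"
  "bracket (x - y) z = bracket x z - bracket y z"
  "bracket (- x) z = - bracket x z"
  "bracket 0 z = 0"
  "bracket (scale c x) z = scale c (bracket x z)"
  by (fact scale_linear_simps[OF bracket_linear(1)] scale_linear_simps[OF bracket_linear(2)])+

lemma bracket_antisym: "bracket y x = - bracket x y"
proof -
  have "bracket y x + bracket x y = bracket (x + y) (x + y)"
    unfolding bracket_algebra_simps(1,6) by (simp add: bracket_self)
  then have "bracket y x + bracket x y = 0" by (simp only: bracket_self)
  then show ?thesis by (simp add: eq_neg_iff_add_eq_0)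
qed

lemma bracket_bracket:
  "bracket (bracket x y) z = bracket x (bracket y z) - bracket y (bracket x z)"
proof -
  have "bracket z (bracket x y) = - bracket (bracket x y) z"
    by (rule bracket_antisym)
  moreover have "bracket y (bracket z x) = - bracket y (bracket x z)"
    by (metis bracket_antisym bracket_algebra_simps(3))
  ultimately show ?thesis
    using jacobi[of x y z] by simp
qed

text \<open>New letters are added innermost, next to the place that \<open>F z v\<close> will
  occupy. The index only bounds the word length, so each level is a vector space, with zero obtained
  from \<open>scaled\<close> at \<open>c = 0\<close>. Levels are needed because the later induction
  must cover all maps of a given degree, not only subwords of \<open>A\<close>.\<close>

inductive ad_degree_le :: "nat \<Rightarrow> ('a \<Rightarrow> 'a) \<Rightarrow> bool" where
  ident: "ad_degree_le n (\<lambda>v. v)"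
| comp_ad: "ad_degree_le n A \<Longrightarrow> ad_degree_le (Suc n) (\<lambda>v. A (bracket w v))"
| plus: "ad_degree_le n A \<Longrightarrow> ad_degree_le n B \<Longrightarrow> ad_degree_le n (\<lambda>v. A v + B v)"
| scaled: "ad_degree_le n A \<Longrightarrow> ad_degree_le n (\<lambda>v. scale c (A v))"

definition ad_envelope :: "('a \<Rightarrow> 'a) set" where
  "ad_envelope = {A. \<exists>n. ad_degree_le n A}"

lemma ad_degree_le_linear:
  assumes "ad_degree_le n A"
  shows "A (x + y) = A x + A y" and "A (scale c x) = scale c (A x)"
  using assms
  by (induction arbitrary: x y)
    (simp_all add: bracket_algebra_simps scale_right_distrib mult.commute)

lemma ad_degree_le_diff:
  assumes "ad_degree_le n A"
  shows "A (x - y) = A x - A y"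
  using ad_degree_le_linear(1)[OF assms, of "x - y" y] by simp

lemma ad_degree_le_Suc: "ad_degree_le n A \<Longrightarrow> ad_degree_le (Suc n) A"
proof (induction rule: ad_degree_le.induct)
  case (comp_ad n A w)
  show ?case by (rule ad_degree_le.comp_ad[OF comp_ad.IH])
next
  case (plus n A B)
  show ?case by (rule ad_degree_le.plus[OF plus.IH])
next
  case (scaled n A c)
  show ?case by (rule ad_degree_le.scaled[OF scaled.IH])
qed (rule ad_degree_le.ident)

lemma ad_degree_le_mono: "ad_degree_le n A \<Longrightarrow> n \<le> k \<Longrightarrow> ad_degree_le k A"
  using lift_Suc_mono_le[of "\<lambda>n. ad_degree_le n A" n k] ad_degree_le_Suc by auto

lemma ad_envelope_id: "(\<lambda>v. v) \<in> ad_envelope"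
  using ad_degree_le.ident by (auto simp: ad_envelope_def)

lemma ad_envelope_scaled: "A \<in> ad_envelope \<Longrightarrow> (\<lambda>v. scale c (A v)) \<in> ad_envelope"
  using ad_degree_le.scaled by (auto simp: ad_envelope_def)

lemma ad_envelope_plus:
  assumes "A \<in> ad_envelope" and "B \<in> ad_envelope"
  shows "(\<lambda>v. A v + B v) \<in> ad_envelope"
proof -
  obtain n k where "ad_degree_le n A" "ad_degree_le k B"
    using assms by (auto simp: ad_envelope_def)
  then have "ad_degree_le (max n k) A" "ad_degree_le (max n k) B"
    by (auto intro: ad_degree_le_mono)
  then show ?thesis
    using ad_degree_le.plus unfolding ad_envelope_def by blast
qed

lemma ad_envelope_diff:
  assumes "A \<in> ad_envelope" and "B \<in> ad_envelope"
  shows "(\<lambda>v. A v - B v) \<in> ad_envelope"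
  using ad_envelope_plus[OF assms(1) ad_envelope_scaled[OF assms(2), of "- 1"]]
  by simp

lemma ad_envelope_comp:
  assumes "A \<in> ad_envelope" and "B \<in> ad_envelope"
  shows "(\<lambda>v. B (A v)) \<in> ad_envelope"
proof -
  obtain n k where A: "ad_degree_le n A" and B: "ad_degree_le k B"
    using assms by (auto simp: ad_envelope_def)
  have "ad_degree_le (k + n) (\<lambda>v. B (A v))"
    using A
  proof (induction rule: ad_degree_le.induct)
    case (ident n)
    show ?case using B by (auto intro: ad_degree_le_mono)
  next
    case (comp_ad n A w)
    show ?case using ad_degree_le.comp_ad[OF comp_ad.IH] by simp
  next
    case (plus n A A')
    show ?case using ad_degree_le.plus[OF plus.IH] by (simp add: ad_degree_le_linear[OF B])
  next
    case (scaled n A c)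
    show ?case using ad_degree_le.scaled[OF scaled.IH] by (simp add: ad_degree_le_linear[OF B])
  qed
  then show ?thesis by (auto simp: ad_envelope_def)
qed

lemma bracket_in_ad_envelope: "bracket w \<in> ad_envelope"
  using ad_degree_le.comp_ad[OF ad_degree_le.ident] by (auto simp: ad_envelope_def)

text \<open>The orbit is the ideal generated by \<open>u\<close>, hence everything in a simple
  algebra once \<open>u \<noteq> 0\<close>.\<close>

lemma lie_ideal_ad_orbit: "lie_ideal ((\<lambda>A. A u) ` ad_envelope)"
  unfolding lie_ideal_def
proof (intro conjI allI ballI subspaceI)
  show "0 \<in> (\<lambda>A. A u) ` ad_envelope"
    using ad_envelope_scaled[OF ad_envelope_id, of 0] by force
next
  fix x y assume "x \<in> (\<lambda>A. A u) ` ad_envelope" "y \<in> (\<lambda>A. A u) ` ad_envelope"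
  then show "x + y \<in> (\<lambda>A. A u) ` ad_envelope"
    using ad_envelope_plus by (force simp: image_iff)
next
  fix c x assume "x \<in> (\<lambda>A. A u) ` ad_envelope"
  then show "scale c x \<in> (\<lambda>A. A u) ` ad_envelope"
    using ad_envelope_scaled by (force simp: image_iff)
next
  fix x y assume "y \<in> (\<lambda>A. A u) ` ad_envelope"
  then show "bracket x y \<in> (\<lambda>A. A u) ` ad_envelope"
    using ad_envelope_comp[OF _ bracket_in_ad_envelope] by (force simp: image_iff)
qed

end

section \<open>Transitivity and two-vector density of the envelope\<close>

context simple_lie_algebra
begin

lemma ad_envelope_transitive:
  assumes "u \<noteq> 0"
  obtains A where "A \<in> ad_envelope" and "A u = x"
proof -
  have "u \<in> (\<lambda>A. A u) ` ad_envelope"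
    using ad_envelope_id by force
  then have "(\<lambda>A. A u) ` ad_envelope = UNIV"
    using ideal_trivial[OF lie_ideal_ad_orbit[of u]] assms by blast
  then show ?thesis using that by (metis UNIV_I image_iff)
qed

end

context central_simple_lie_algebra
begin

text \<open>The two-vector case of the Jacobson density theorem: otherwise \<open>A u \<mapsto> A w\<close> would be a
  well-defined element of the centroid.\<close>

lemma ad_envelope_dense:
  assumes "u \<noteq> 0" and nonmult: "\<And>c. w \<noteq> scale c u"
  obtains A where "A \<in> ad_envelope" and "A u = 0" and "A w \<noteq> 0"
proof (rule ccontr)
  assume "\<not> thesis"
  then have zero: "A w = 0" if "A \<in> ad_envelope" "A u = 0" for A
    using that(1,2) \<open>\<And>A. A \<in> ad_envelope \<Longrightarrow> A u = 0 \<Longrightarrow> A w \<noteq> 0 \<Longrightarrow> thesis\<close> by blast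
  \<comment> \<open>Two elements of the envelope that agree at \<open>u\<close> differ by one that
    kills \<open>u\<close>, hence \<open>w\<close> by \<open>zero\<close>; so the choice does not
    affect the value.\<close>
  define \<phi> where "\<phi> x = (SOME A. A \<in> ad_envelope \<and> A u = x) w" for x
  have \<phi>: "\<phi> (A u) = A w" if A: "A \<in> ad_envelope" for A
  proof -
    define B where "B = (SOME B. B \<in> ad_envelope \<and> B u = A u)"
    have B: "B \<in> ad_envelope \<and> B u = A u"
      unfolding B_def by (rule someI[of _ A]) (use A in simp)
    then have "B w - A w = 0"
      using zero[OF ad_envelope_diff[of B A]] A by simp
    then show ?thesis by (simp add: \<phi>_def B_def)
  qed
  have "\<phi> \<in> centroid"
    unfolding centroid_def
  proof (intro CollectI conjI allI)
    show "Vector_Spaces.linear scale scale \<phi>"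
      unfolding Vector_Spaces.linear_def module_hom_def module_hom_axioms_def
    proof (intro conjI allI)
      fix x y
      obtain A B where "A \<in> ad_envelope" "A u = x" "B \<in> ad_envelope" "B u = y"
        using ad_envelope_transitive[OF \<open>u \<noteq> 0\<close>] by metis
      then show "\<phi> (x + y) = \<phi> x + \<phi> y"
        using \<phi> \<phi>[OF ad_envelope_plus[of A B]] by auto
    next
      fix c x
      obtain A where "A \<in> ad_envelope" "A u = x"
        using ad_envelope_transitive[OF \<open>u \<noteq> 0\<close>] by metis
      then show "\<phi> (scale c x) = scale c (\<phi> x)"
        using \<phi> \<phi>[OF ad_envelope_scaled[of A c]] by auto
    qed (rule vector_space_axioms module_axioms)+
  next
    fix x y
    obtain A where A: "A \<in> ad_envelope" "A u = x"
      using ad_envelope_transitive[OF \<open>u \<noteq> 0\<close>] by metis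
    \<comment> \<open>The envelope brackets from the left while the centroid condition has
      \<open>y\<close> on the right; \<open>[x, y] = [-y, x]\<close> mediates.\<close>
    have "(\<lambda>v. bracket (- y) (A v)) \<in> ad_envelope"
      by (rule ad_envelope_comp[OF A(1) bracket_in_ad_envelope])
    from \<phi>[OF this] have "\<phi> (bracket (- y) x) = bracket (- y) (\<phi> x)"
      using A \<phi> by auto
    then show "\<phi> (bracket x y) = bracket (\<phi> x) y"
      by (simp add: bracket_algebra_simps bracket_antisym[of y])
  qed
  then obtain c where "\<phi> = scale c"
    unfolding centroid_scalars by auto
  then have "w = scale c u"
    using \<phi>[OF ad_envelope_id] by simp
  then show False using nonmult by blast
qed

end

section \<open>Identities for a CPA-structure\<close>

locale cpa_lie_algebra = lie_algebra scale bracket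
  for scale :: "'k::field \<Rightarrow> 'a::ab_group_add \<Rightarrow> 'a" and bracket +
  fixes mul :: "'a \<Rightarrow> 'a \<Rightarrow> 'a"
  assumes cpa: "cpa_structure mul"
begin

lemma mul_algebra_simps:
  "mul x (y + z) = mul x y + mul x z"
  "mul x (y - z) = mul x y - mul x z"
  "mul x 0 = 0"
  "mul x (scale c y) = scale c (mul x y)"
  "mul (x + y) z = mul x z + mul y z"
  "mul (x - y) z = mul x z - mul y z"
  "mul 0 z = 0"
  "mul (scale c x) z = scale c (mul x z)"
proof -
  have linear: "Vector_Spaces.linear scale scale (mul x)"
    "Vector_Spaces.linear scale scale (\<lambda>x. mul x z)" for x z
    using cpa by (simp_all add: cpa_structure_def bilinear_over_def)
  show "mul x (y + z) = mul x y + mul x z"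
    "mul x (y - z) = mul x y - mul x z"
    "mul x 0 = 0"
    "mul x (scale c y) = scale c (mul x y)"
    "mul (x + y) z = mul x z + mul y z"
    "mul (x - y) z = mul x z - mul y z"
    "mul 0 z = 0"
    "mul (scale c x) z = scale c (mul x z)"
    by (fact scale_linear_simps[OF linear(1)] scale_linear_simps[OF linear(2)])+
qed

lemma mul_commute: "mul x y = mul y x"
  and mul_bracket_left: "mul (bracket x y) z = mul x (mul y z) - mul y (mul x z)"
  and mul_bracket_right: "mul x (bracket y z) = bracket (mul x y) z + bracket y (mul x z)"
  using cpa unfolding cpa_structure_def by blast+

definition F :: "'a \<Rightarrow> 'a \<Rightarrow> 'a" where
  "F x v = mul x v + bracket x v"

text \<open>In the commutator of \<open>F x\<close> and \<open>F y\<close> the cross terms are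
  \<open>ad (mul x y)\<close> and \<open>- ad (mul y x)\<close>, since multiplications are
  derivations; they cancel by commutativity.\<close>

lemma F_bracket: "F (bracket x y) v = F x (F y v) - F y (F x v)"
  by (simp add: F_def mul_algebra_simps bracket_algebra_simps mul_bracket_left mul_bracket_right
      bracket_bracket mul_commute[of y x] algebra_simps)

text \<open>Evaluate \<open>mul v (bracket y z)\<close> twice, by the representation law and by the
  derivation law.\<close>

lemma mul_F_commute: "mul y (F z v) = mul z (F y v)"
proof -
  have "mul y (mul z v) - mul z (mul y v) = mul v (bracket y z)"
    by (simp add: mul_bracket_left mul_commute[of v])
  also have "\<dots> = bracket (mul y v) z + bracket y (mul z v)"
    by (simp add: mul_bracket_right mul_commute[of v])
  \<comment> \<open>Expanding the right side produces \<open>bracket (mul y z) v\<close> twice with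
    opposite signs.\<close>
  also have "\<dots> = mul z (bracket y v) - mul y (bracket z v)"
    by (simp add: mul_bracket_right mul_commute[of z y] bracket_antisym[of _ z]
        bracket_antisym[of "mul y z"])
  finally show ?thesis
    by (simp add: F_def mul_algebra_simps algebra_simps)
qed

text \<open>By the Leibniz rule, commuting with \<open>mul x\<close> replaces one letter
  \<open>w\<close> of a word at a time by \<open>mul x w\<close>, which keeps the length.\<close>

lemma mul_commutator_ad_degree_le:
  "ad_degree_le n A \<Longrightarrow> ad_degree_le n (\<lambda>v. mul x (A v) - A (mul x v))"
proof (induction rule: ad_degree_le.induct)
  case (ident n)
  show ?case using ad_degree_le.scaled[OF ad_degree_le.ident, of n 0] by simp
next
  case (comp_ad n A w)
  have eq: "mul x (A (bracket w v)) - A (bracket w (mul x v)) =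
      (mul x (A (bracket w v)) - A (mul x (bracket w v))) + A (bracket (mul x w) v)" for v
    by (simp add: mul_bracket_right ad_degree_le_linear[OF comp_ad.hyps])
  show ?case
    unfolding eq
    by (rule ad_degree_le.plus[OF ad_degree_le.comp_ad[OF comp_ad.IH, of w]
        ad_degree_le.comp_ad[OF comp_ad.hyps, of "mul x w"]])
next
  case (plus n A B)
  show ?case
    using ad_degree_le.plus[OF plus.IH]
    by (simp add: mul_algebra_simps algebra_simps)
next
  case (scaled n A c)
  show ?case
    using ad_degree_le.scaled[OF scaled.IH, of c]
    by (simp add: mul_algebra_simps scale_right_diff_distrib)
qed

text \<open>This is the induction step that appends the letter \<open>w\<close> to \<open>A\<close>;
  \<open>IH\<close> is used for \<open>A\<close> and for its commutators with
  multiplications.\<close>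

lemma mul_comp_bracket_F_commute:
  assumes A: "ad_degree_le n A"
    and IH: "\<And>B y z v. ad_degree_le n B \<Longrightarrow> mul y (B (F z v)) = mul z (B (F y v))"
  shows "mul y (A (bracket w (F z v))) = mul z (A (bracket w (F y v)))"
proof -
  \<comment> \<open>Write \<open>ad w\<close> as \<open>F w\<close> minus multiplication by
    \<open>w\<close>, then move \<open>w\<close> outward by \<open>IH\<close>.\<close>
  have expand: "mul y (A (bracket w (F z v))) = mul w (A (F y (F z v))) - mul y (A (mul z (F w v)))"
    for y z
  proof -
    have "bracket w (F z v) = F w (F z v) - mul z (F w v)"
      by (simp add: F_def[of w "F z v"] mul_F_commute[of z])
    then show ?thesis
      by (simp add: ad_degree_le_diff[OF A] mul_algebra_simps IH[OF A, of y w])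
  qed
  \<comment> \<open>Antisymmetrizing the first term of \<open>expand\<close> in \<open>y, z\<close>
    turns it into a commutator of multiplications.\<close>
  have "mul w (A (F y (F z v))) - mul w (A (F z (F y v))) = mul w (A (F (bracket y z) v))"
    by (simp add: F_bracket ad_degree_le_diff[OF A] mul_algebra_simps)
  also have "\<dots> = mul (bracket y z) (A (F w v))"
    by (rule IH[OF A])
  finally have rep: "mul w (A (F y (F z v))) - mul w (A (F z (F y v))) =
      mul y (mul z (A (F w v))) - mul z (mul y (A (F w v)))"
    by (simp add: mul_bracket_left)
  have comm: "mul y (mul z (A (F w v))) - mul y (A (mul z (F w v))) =
      mul w (mul z (A (F y v))) - mul w (A (mul z (F y v)))" for y z
    using IH[OF mul_commutator_ad_degree_le[OF A], of y z w v] by (simp add: mul_algebra_simps)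
  \<comment> \<open>The right side of \<open>comm\<close> is symmetric in \<open>y\<close> and
    \<open>z\<close>, hence so is its left side.\<close>
  have "mul w (mul z (A (F y v))) - mul w (A (mul z (F y v))) =
      mul w (mul y (A (F z v))) - mul w (A (mul y (F z v)))"
    by (simp add: IH[OF A, of z y] mul_F_commute[of z y])
  then have "mul y (mul z (A (F w v))) - mul y (A (mul z (F w v))) =
      mul z (mul y (A (F w v))) - mul z (A (mul y (F w v)))"
    by (simp only: comm)
  moreover have "a - b = a' - b'" if "a - a' = p - q" "p - b = q - b'" for a a' b b' p q :: 'a
  proof -
    have "a = p - q + a'" using that(1) by (simp add: diff_eq_eq)
    moreover have "p = q - b' + b" using that(2) by (simp add: diff_eq_eq)
    ultimately show ?thesis by simp
  qed
  ultimately show ?thesis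
    unfolding expand using rep by blast
qed

text \<open>The outer induction supplies the identity for all maps of smaller degree, including the
  commutators; the inner one handles sums and multiples within a degree.\<close>

lemma mul_ad_degree_le_F_commute:
  "ad_degree_le n A \<Longrightarrow> mul y (A (F z v)) = mul z (A (F y v))"
proof (induction n arbitrary: A y z v rule: less_induct)
  case (less n)
  from less.prems less.IH show ?case
  proof (induction rule: ad_degree_le.induct)
    case (ident n)
    show ?case by (rule mul_F_commute)
  next
    case (comp_ad n A w)
    show ?case
      by (rule mul_comp_bracket_F_commute[OF comp_ad.hyps]) (auto intro: comp_ad.prems)
  qed (simp_all add: mul_algebra_simps)
qed

lemma mul_ad_envelope_F_commute:
  "A \<in> ad_envelope \<Longrightarrow> mul y (A (F z v)) = mul z (A (F y v))"
  using mul_ad_degree_le_F_commute by (auto simp: ad_envelope_def)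

text \<open>Kernel of the representation \<open>mul\<close>; simplicity will make a nonzero product
  faithful.\<close>

lemma lie_ideal_annihilator: "lie_ideal {y. \<forall>v. mul y v = 0}"
  by (auto simp: lie_ideal_def subspace_def mul_algebra_simps mul_bracket_left)

end

section \<open>Vanishing of the product in the central simple case\<close>

locale cpa_central_simple_lie_algebra =
  cpa_lie_algebra scale bracket mul + central_simple_lie_algebra scale bracket
  for scale :: "'k::field \<Rightarrow> 'a::ab_group_add \<Rightarrow> 'a" and bracket mul
begin

text \<open>Otherwise all brackets would be multiples of \<open>bracket y y = 0\<close>.\<close>

lemma ex_nonmultiple: "\<exists>z. \<forall>c. z \<noteq> scale c y"
proof (rule ccontr)
  assume "\<not> ?thesis"
  then have "\<forall>z. \<exists>c. z = scale c y" by blast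
  then have "bracket a b = 0" for a b
    by (metis bracket_algebra_simps(5,10) bracket_self scale_zero_right)
  then show False using not_abelian by (simp add: abelian_def)
qed

lemma F_eq_0:
  assumes "mul a b \<noteq> 0"
  shows "F y v = 0"
proof (rule ccontr)
  assume u: "F y v \<noteq> 0"
  have "{y. \<forall>v. mul y v = 0} \<noteq> UNIV" using assms by auto
  then have "{y. \<forall>v. mul y v = 0} = {0}"
    using ideal_trivial[OF lie_ideal_annihilator] by blast
  then have faithful: "y = 0" if "\<And>v. mul y v = 0" for y
    using that by blast
  obtain z where z: "\<And>c. z \<noteq> scale c y" using ex_nonmultiple by blast
  show False
  proof (cases "\<exists>c. F z v = scale c (F y v)")
    case True
    then obtain c where c: "F z v = scale c (F y v)" by blast
    \<comment> \<open>As \<open>A (F y v)\<close> runs through all \<open>x\<close>, the identity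
      reads \<open>scale c (mul y x) = mul z x\<close>.\<close>
    have "mul (z - scale c y) x = 0" for x
    proof -
      obtain A where A: "A \<in> ad_envelope" "A (F y v) = x"
        by (rule ad_envelope_transitive[OF u])
      then have "A (F z v) = scale c x"
        using ad_degree_le_linear(2) by (auto simp: c ad_envelope_def)
      then show ?thesis
        using mul_ad_envelope_F_commute[OF A(1), of y z v] A(2)
        by (simp add: mul_algebra_simps)
    qed
    then have "z - scale c y = 0" by (rule faithful)
    then show False using z by simp
  next
    case False
    then obtain A where A: "A \<in> ad_envelope" "A (F y v) = 0" "A (F z v) \<noteq> 0"
      using ad_envelope_dense[OF u] by metis
    \<comment> \<open>The composite of \<open>A\<close> and \<open>B\<close> kills
      \<open>F y v\<close> and sends \<open>F z v\<close> to \<open>x\<close>, so one side of the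
      identity vanishes.\<close>
    have "mul y x = 0" for x
    proof -
      obtain B where B: "B \<in> ad_envelope" "B (A (F z v)) = x"
        by (rule ad_envelope_transitive[OF A(3)])
      have "B 0 = 0"
        using B(1) ad_degree_le_diff[of _ B 0 0] by (auto simp: ad_envelope_def)
      then show ?thesis
        using mul_ad_envelope_F_commute[OF ad_envelope_comp[OF A(1) B(1)], of y z v] A(2) B(2)
        by (simp add: mul_algebra_simps)
    qed
    then have "y = 0" by (rule faithful)
    then show False using u by (simp add: F_def mul_algebra_simps bracket_algebra_simps)
  qed
qed

lemma mul_eq_0:
  assumes "(2::'k) \<noteq> 0"
  shows "mul x y = 0"
proof (rule ccontr)
  assume "mul x y \<noteq> 0"
  then have mul: "mul a b = - bracket a b" for a b
    using F_eq_0[of x y a b] by (simp add: F_def eq_neg_iff_add_eq_0)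
  have "bracket a b = 0" for a b
  proof -
    have "bracket a b = - bracket a b"
      using mul_commute[of a b] bracket_antisym[of b a] by (simp add: mul)
    then have "scale 2 (bracket a b) = 0"
      using scale_left_distrib[of 1 1 "bracket a b"] by (simp add: eq_neg_iff_add_eq_0)
    then show ?thesis using assms by simp
  qed
  then show False using not_abelian by (simp add: abelian_def)
qed

end

theorem theorem5p7:
  fixes scale :: "'k::field \<Rightarrow> 'a::ab_group_add \<Rightarrow> 'a"
    and bracket :: "'a \<Rightarrow> 'a \<Rightarrow> 'a"
    and p :: nat
  assumes "CHAR('k) = p" and "p > 3"
    and "central_simple_lie_algebra scale bracket"
  shows "\<forall>m. lie_algebra.cpa_structure scale bracket m \<longrightarrow> (\<forall>x y. m x y = 0)"
proof (intro allI impI)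
  fix m x y
  interpret central_simple_lie_algebra scale bracket by fact
  assume "cpa_structure m"
  then interpret cpa_central_simple_lie_algebra scale bracket m
    by unfold_locales
  have "\<not> CHAR('k) dvd 2"
    using assms(1,2) by (auto dest: dvd_imp_le)
  then have "(2::'k) \<noteq> 0"
    using of_nat_eq_0_iff_char_dvd[of 2, where ?'a = 'k] by simp
  then show "m x y = 0" by (rule mul_eq_0)
qed

end
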